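(* Let $A,C\in\mathbb{R}^{m\times m}$ and $B,D\in\mathbb{R}^{p\times p}$, where $A$ and $B$ are nonsingular. If $$\sigma_{1}(B^{-1}D)\,\sigma_{1}(CA^{-1})<1,$$ then for every $F\in\mathbb{R}^{m\times p}$ the equation $$AXB-|CXD|=F$$ has a unique solution $X\in\mathbb{R}^{m\times p}$.
   Context: $|M|$ denotes the entrywise absolute value of a real matrix $M$; $\sigma_1(\cdot)$ denotes the largest singular value. The equation $AXB-|CXD|=F$ is called the new Sylvester-like absolute value equation; in general $A,C\in\mathbb{R}^{m\times n}$, $B,D\in\mathbb{R}^{p\times q}$, $F\in\mathbb{R}^{m\times q}$, and $X\in\mathbb{R}^{n\times p}$ is the unknown. Here $A$ and $B$ are square, so $m=n$ and $p=q$. *)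

theory Defs
  imports "HOL-Analysis.Analysis"
begin

definition eigenvalue :: "real^'n^'n \<Rightarrow> real \<Rightarrow> bool" where
  "eigenvalue M l \<longleftrightarrow> (\<exists>v. v \<noteq> 0 \<and> M *v v = l *s v)"

(* Singular values as a set, without multiplicities. The matrix transpose M ** M is
   real symmetric and positive semidefinite, so its spectrum is real and nonnegative
   and restricting to real eigenvalues loses nothing. *)
definition singular_values :: "real^'n^'n \<Rightarrow> real set" where
  "singular_values M = {sqrt l | l. eigenvalue (transpose M ** M) l}"

(* The set of singular values of a square matrix is finite and nonempty
   (index types are nonempty), so Max really is its largest element. *)
definition sigma1 :: "real^'n^'n \<Rightarrow> real" where
  "sigma1 M = Max (singular_values M)"

(* The library's absolute value on vec, nested twice, is the entrywise absolute value. *)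
lemma abs_matrix_nth: "\<bar>M\<bar> $ i $ j = \<bar>M $ i $ j\<bar>" for M :: "real^'q^'m"
  by (simp add: abs_vec_def)

end

theory Submission
  imports Defs
begin

text \<open>
  Substituting \<open>Y = A X B\<close> turns the equation into the fixed point problem
  \<open>Y = F + |G Y H|\<close> with \<open>G = C A\<^sup>-\<^sup>1\<close> and \<open>H = B\<^sup>-\<^sup>1 D\<close>. In the Frobenius norm the
  entrywise absolute value is nonexpansive and \<open>Y \<mapsto> G Y H\<close> has Lipschitz constant
  \<open>\<sigma>\<^sub>1(G) \<sigma>\<^sub>1(H) < 1\<close>, so Banach's fixed point theorem applies.
\<close>

text \<open>Eigenvectors of a symmetric matrix for distinct eigenvalues are orthogonal, hence
  independent, and an independent set in finite dimension is finite. This is what lets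
  \<open>Max_ge\<close> be applied to \<open>sigma1\<close> later on.\<close>

lemma finite_eigenvalues_symmetric:
  fixes S :: "real^'n^'n"
  assumes "transpose S = S"
  shows "finite {l. eigenvalue S l}"
proof -
  \<comment> \<open>With the implication under the existential, \<open>choice\<close> yields a total
    function \<open>v\<close> that selects one eigenvector per eigenvalue.\<close>
  have "\<forall>l. \<exists>v. eigenvalue S l \<longrightarrow> v \<noteq> 0 \<and> S *v v = l *s v"
    unfolding eigenvalue_def by blast
  from choice[OF this] obtain v
    where v: "\<And>l. eigenvalue S l \<Longrightarrow> v l \<noteq> 0 \<and> S *v v l = l *s v l" by blast
  have orth: "v a \<bullet> v b = 0" if "eigenvalue S a" "eigenvalue S b" "a \<noteq> b" for a b
  proof -
    have "a * (v a \<bullet> v b) = (S *v v a) \<bullet> v b"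
      using v[OF that(1)] by (simp add: scalar_mult_eq_scaleR)
    also have "\<dots> = v a \<bullet> (S *v v b)"
      using assms by (metis dot_lmul_matrix transpose_matrix_vector)
    also have "\<dots> = b * (v a \<bullet> v b)"
      using v[OF that(2)] by (simp add: scalar_mult_eq_scaleR)
    finally show ?thesis using that(3) by simp
  qed
  let ?V = "v ` {l. eigenvalue S l}"
  have "pairwise orthogonal ?V"
    by (auto simp: pairwise_def orthogonal_def intro: orth)
  moreover have "0 \<notin> ?V" using v by force
  ultimately have "finite ?V"
    by (metis pairwise_orthogonal_independent independent_imp_finite)
  \<comment> \<open>If \<open>v a = v b\<close> with \<open>a\<close> and \<open>b\<close> distinct,
    then \<open>v a\<close> is orthogonal to itself, so it is zero.\<close>
  moreover have "inj_on v {l. eigenvalue S l}"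
    using orth v by (metis inj_onI inner_eq_zero_iff mem_Collect_eq)
  ultimately show ?thesis by (rule finite_imageD)
qed

lemma inner_gram:
  fixes M :: "real^'n^'m"
  shows "x \<bullet> ((transpose M ** M) *v y) = (M *v x) \<bullet> (M *v y)"
  by (metis dot_lmul_matrix matrix_vector_mul_assoc transpose_matrix_vector transpose_transpose)

lemma finite_singular_values: "finite (singular_values M)"
proof -
  have "finite {l. eigenvalue (transpose M ** M) l}"
    by (rule finite_eigenvalues_symmetric) (simp add: matrix_transpose_mul)
  then show ?thesis
    unfolding singular_values_def by simp
qed

text \<open>A maximiser of \<open>norm (M *v x)\<close> on the unit sphere is an eigenvector of \<open>transpose M ** M\<close>,
  since the quadratic form \<open>l * (norm x)\<^sup>2 - (norm (M *v x))\<^sup>2\<close> is nonnegative and vanishes there.\<close>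

lemma gram_eigenvalue_bounding_norm:
  fixes M :: "real^'n^'m"
  obtains l where "eigenvalue (transpose M ** M) l"
    and "\<And>x. norm (M *v x) \<le> sqrt l * norm x"
proof -
  have "compact (sphere (0::real^'n) 1)" by simp
  moreover have "sphere (0::real^'n) 1 \<noteq> {}" by simp
  moreover have "continuous_on (sphere 0 1) (\<lambda>x. norm (M *v x))"
    by (intro continuous_intros)
  ultimately obtain u where u: "u \<in> sphere 0 1"
    and umax: "\<And>x. x \<in> sphere 0 1 \<Longrightarrow> norm (M *v x) \<le> norm (M *v u)"
    using continuous_attains_sup by metis
  define s where "s = norm (M *v u)"
  have bound: "norm (M *v x) \<le> s * norm x" for x
  proof (cases "x = 0")
    case False
    have "norm (M *v ((1 / norm x) *\<^sub>R x)) \<le> s"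
      unfolding s_def using False by (intro umax) simp
    then show ?thesis
      using False by (simp add: matrix_vector_mult_scaleR field_simps)
  qed simp
  \<comment> \<open>\<open>r\<close> is the residual of the eigenvalue equation and half the
    gradient of the form \<open>q\<close> defined next, at \<open>u\<close>. Since \<open>q\<close>
    has a minimum there, moving from \<open>u\<close> along \<open>r\<close> will force
    \<open>r = 0\<close>.\<close>
  define r where "r = s\<^sup>2 *\<^sub>R u - (transpose M ** M) *v u"
  define q where "q x = s\<^sup>2 * (x \<bullet> x) - (M *v x) \<bullet> (M *v x)" for x
  have q_nonneg: "0 \<le> q x" for x
  proof -
    have "(norm (M *v x))\<^sup>2 \<le> (s * norm x)\<^sup>2"
      by (intro power_mono bound) simp
    then show ?thesis
      unfolding q_def by (simp add: power_mult_distrib power2_norm_eq_inner)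
  qed
  have qu: "q u = 0"
    using u unfolding q_def s_def by (simp add: power2_norm_eq_inner norm_eq_1)
  have expand: "q (u + t *\<^sub>R r) = 2 * t * (r \<bullet> r) + t\<^sup>2 * q r" for t
  proof -
    have "r \<bullet> r = s\<^sup>2 * (r \<bullet> u) - (M *v r) \<bullet> (M *v u)"
      by (subst (2) r_def) (simp add: inner_diff_right inner_gram)
    moreover have "q (u + t *\<^sub>R r)
        = q u + 2 * t * (s\<^sup>2 * (r \<bullet> u) - (M *v r) \<bullet> (M *v u)) + t\<^sup>2 * q r"
      unfolding q_def
      by (simp add: matrix_vector_right_distrib matrix_vector_mult_scaleR inner_add_left
          inner_add_right inner_commute power2_eq_square algebra_simps)
    ultimately show ?thesis using qu by simp
  qed
  have "r \<bullet> r = 0"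
  proof (rule ccontr)
    assume "r \<bullet> r \<noteq> 0"
    then have rr: "0 < r \<bullet> r" by (simp add: order_less_le)
    \<comment> \<open>The \<open>+ 1\<close> keeps the denominator positive even when
      \<open>q r = 0\<close>. With this \<open>t\<close> the expansion equals
      \<open>t * (r \<bullet> r - t)\<close>, which is negative because
      \<open>t < 0\<close>.\<close>
    define t where "t = - (r \<bullet> r) / (q r + 1)"
    have "0 \<le> 2 * t * (r \<bullet> r) + t\<^sup>2 * q r"
      using q_nonneg expand by metis
    moreover have "t < 0" "t * (q r + 1) = - (r \<bullet> r)"
      using rr q_nonneg[of r] unfolding t_def
      by (auto simp: divide_neg_pos)
    moreover have "2 * t * (r \<bullet> r) + t\<^sup>2 * q r = t * (2 * (r \<bullet> r) + t * (q r + 1) - t)"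
      by (simp add: power2_eq_square algebra_simps)
    ultimately show False
      using rr by (simp add: zero_le_mult_iff)
  qed
  then have "(transpose M ** M) *v u = s\<^sup>2 *s u"
    unfolding r_def by (simp add: scalar_mult_eq_scaleR)
  moreover have "u \<noteq> 0" using u by auto
  ultimately have "eigenvalue (transpose M ** M) (s\<^sup>2)"
    unfolding eigenvalue_def by blast
  moreover have "sqrt (s\<^sup>2) = s" by (simp add: s_def)
  ultimately show thesis using bound that by metis
qed

lemma norm_matrix_vector_le_sigma1:
  fixes M :: "real^'n^'n"
  shows "norm (M *v x) \<le> sigma1 M * norm x"
proof -
  obtain l where l: "eigenvalue (transpose M ** M) l"
    and bound: "norm (M *v x) \<le> sqrt l * norm x"
    using gram_eigenvalue_bounding_norm by metis
  have "sqrt l \<le> sigma1 M"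
    unfolding sigma1_def using l
    by (intro Max_ge finite_singular_values) (auto simp: singular_values_def)
  then have "sqrt l * norm x \<le> sigma1 M * norm x"
    by (simp add: mult_right_mono)
  then show ?thesis using bound by linarith
qed

lemma sigma1_nonneg: "0 \<le> sigma1 M"
proof -
  have "norm (M *v axis undefined 1) \<le> sigma1 M * 1"
    using norm_matrix_vector_le_sigma1[of M "axis undefined 1"] by simp
  then show ?thesis
    using norm_ge_zero[of "M *v axis undefined 1"] by linarith
qed

text \<open>Duality gives the transpose the same bound without comparing the spectra of the two Gram
  matrices: for \<open>y = x v* M\<close>, the square of \<open>norm y\<close> is
  \<open>x \<bullet> (M *v y)\<close>, and after Cauchy-Schwarz one factor \<open>norm y\<close>
  cancels.\<close>

lemma norm_vector_matrix_le_sigma1: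
  fixes M :: "real^'n^'n"
  shows "norm (x v* M) \<le> sigma1 M * norm x"
proof (cases "x v* M = 0")
  case False
  let ?y = "x v* M"
  have "norm ?y * norm ?y = x \<bullet> (M *v ?y)"
    by (metis dot_lmul_matrix power2_eq_square power2_norm_eq_inner)
  also have "\<dots> \<le> norm x * norm (M *v ?y)"
    by (rule norm_cauchy_schwarz)
  also have "\<dots> \<le> norm x * (sigma1 M * norm ?y)"
    by (intro mult_left_mono norm_matrix_vector_le_sigma1) simp
  finally have "norm ?y * norm ?y \<le> (sigma1 M * norm x) * norm ?y"
    by (simp add: mult_ac)
  then show ?thesis using False by simp
qed (simp add: sigma1_nonneg)

text \<open>The norm on the nested vector type is the L2 norm of the row norms, that is, the
  Frobenius norm, so a uniform bound on rows carries over to matrices.\<close>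

lemma norm_matrix_le_rowwise:
  fixes P :: "real^'q^'m" and Q :: "real^'p^'m"
  assumes "\<And>i. norm (P $ i) \<le> c * norm (Q $ i)" and "0 \<le> c"
  shows "norm P \<le> c * norm Q"
proof -
  have "L2_set (\<lambda>i. norm (P $ i)) UNIV \<le> L2_set (\<lambda>i. c * norm (Q $ i)) UNIV"
    by (rule L2_set_mono) (simp_all add: assms(1))
  then show ?thesis
    by (simp only: norm_vec_def[of P] norm_vec_def[of Q] L2_set_right_distrib[OF assms(2)])
qed

lemma norm_transpose_matrix:
  fixes P :: "real^'p^'m"
  shows "norm (transpose P) = norm P"
  unfolding norm_eq_sqrt_inner inner_vec_def transpose_def
  by (subst sum.swap) simp

lemma norm_matrix_mult_right_le_sigma1:
  fixes Y :: "real^'p^'m" and H :: "real^'p^'p"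
  shows "norm (Y ** H) \<le> sigma1 H * norm Y"
proof (rule norm_matrix_le_rowwise)
  fix i
  have "(Y ** H) $ i = Y $ i v* H"
    by (simp add: vec_eq_iff matrix_matrix_mult_def vector_matrix_mult_def mult.commute)
  then show "norm ((Y ** H) $ i) \<le> sigma1 H * norm (Y $ i)"
    by (simp add: norm_vector_matrix_le_sigma1)
qed (rule sigma1_nonneg)

text \<open>Left multiplication acts on columns while the norm is assembled from rows, so the
  estimate is made on transposes, which have the same Frobenius norm.\<close>

lemma norm_matrix_mult_left_le_sigma1:
  fixes Y :: "real^'p^'m" and G :: "real^'m^'m"
  shows "norm (G ** Y) \<le> sigma1 G * norm Y"
proof -
  have "norm (transpose (G ** Y)) \<le> sigma1 G * norm (transpose Y)"
  proof (rule norm_matrix_le_rowwise)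
    fix i
    have "transpose (G ** Y) $ i = G *v (transpose Y $ i)"
      by (simp add: vec_eq_iff matrix_matrix_mult_def matrix_vector_mult_def transpose_def)
    then show "norm (transpose (G ** Y) $ i) \<le> sigma1 G * norm (transpose Y $ i)"
      by (simp add: norm_matrix_vector_le_sigma1)
  qed (rule sigma1_nonneg)
  then show ?thesis by (simp add: norm_transpose_matrix)
qed

lemma norm_abs_matrix_diff_le:
  fixes P Q :: "real^'p^'m"
  shows "norm (\<bar>P\<bar> - \<bar>Q\<bar>) \<le> norm (P - Q)"
proof -
  have "norm ((\<bar>P\<bar> - \<bar>Q\<bar>) $ i) \<le> norm ((P - Q) $ i)" for i
    by (rule norm_le_componentwise_cart) (simp add: abs_matrix_nth abs_triangle_ineq3)
  then show ?thesis
    using norm_matrix_le_rowwise[of "\<bar>P\<bar> - \<bar>Q\<bar>" 1 "P - Q"] by simp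
qed

lemma matrix_diff_ldistrib:
  fixes A :: "'a::ring_1^'n^'m"
  shows "A ** (B - C) = A ** B - A ** C"
  by (simp add: vec_eq_iff matrix_matrix_mult_def right_diff_distrib sum_subtractf)

lemma matrix_diff_rdistrib:
  fixes A :: "'a::ring_1^'n^'m"
  shows "(A - B) ** C = A ** C - B ** C"
  by (simp add: vec_eq_iff matrix_matrix_mult_def left_diff_distrib sum_subtractf)

lemma
  assumes "invertible A"
  shows matrix_inv_right: "A ** matrix_inv A = mat 1"
    and matrix_inv_left: "matrix_inv A ** A = mat 1"
  using someI_ex[OF assms[unfolded invertible_def]] unfolding matrix_inv_def by auto

lemma ex1_fixed_point_abs:
  fixes G :: "real^'m^'m" and H :: "real^'p^'p" and F :: "real^'p^'m"
  assumes "sigma1 H * sigma1 G < 1"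
  shows "\<exists>!Y. F + \<bar>G ** Y ** H\<bar> = Y"
proof (rule banach_fix_type[OF _ assms])
  show "0 \<le> sigma1 H * sigma1 G"
    by (simp add: sigma1_nonneg)
  have "norm (\<bar>G ** Y ** H\<bar> - \<bar>G ** Z ** H\<bar>) \<le> sigma1 H * sigma1 G * norm (Y - Z)" for Y Z
  proof -
    have "norm (\<bar>G ** Y ** H\<bar> - \<bar>G ** Z ** H\<bar>) \<le> norm (G ** Y ** H - G ** Z ** H)"
      by (rule norm_abs_matrix_diff_le)
    also have "G ** Y ** H - G ** Z ** H = G ** (Y - Z) ** H"
      by (simp only: matrix_diff_ldistrib matrix_diff_rdistrib)
    also have "norm \<dots> \<le> sigma1 H * norm (G ** (Y - Z))"
      by (rule norm_matrix_mult_right_le_sigma1)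
    also have "\<dots> \<le> sigma1 H * (sigma1 G * norm (Y - Z))"
      by (intro mult_left_mono norm_matrix_mult_left_le_sigma1 sigma1_nonneg)
    finally show ?thesis by (simp add: mult.assoc)
  qed
  then show "\<forall>Y Z. dist (F + \<bar>G ** Y ** H\<bar>) (F + \<bar>G ** Z ** H\<bar>)
      \<le> sigma1 H * sigma1 G * dist Y Z"
    by (simp add: dist_norm)
qed

theorem theorem2p3:
  fixes A C :: "real^'m^'m" and B D :: "real^'p^'p"
  assumes "invertible A" and "invertible B"
    and "sigma1 (matrix_inv B ** D) * sigma1 (C ** matrix_inv A) < 1"
  shows "\<forall>F :: real^'p^'m. \<exists>!X :: real^'p^'m. A ** X ** B - \<bar>C ** X ** D\<bar> = F"
proof
  fix F :: "real^'p^'m"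
  let ?G = "C ** matrix_inv A" and ?H = "matrix_inv B ** D"
  \<comment> \<open>\<open>\<phi>\<close> is the substitution and \<open>\<psi>\<close> its
    two-sided inverse, so existence and uniqueness both pass from fixed points back to
    solutions.\<close>
  define \<phi> where "\<phi> X = A ** X ** B" for X :: "real^'p^'m"
  define \<psi> where "\<psi> Y = matrix_inv A ** Y ** matrix_inv B" for Y :: "real^'p^'m"
  have "\<phi> (\<psi> Y) = (A ** matrix_inv A) ** Y ** (matrix_inv B ** B)" for Y
    unfolding \<phi>_def \<psi>_def by (simp only: matrix_mul_assoc)
  then have \<phi>\<psi>: "\<phi> (\<psi> Y) = Y" for Y
    using assms(1,2) by (simp add: matrix_inv_left matrix_inv_right)
  have "\<psi> (\<phi> X) = (matrix_inv A ** A) ** X ** (B ** matrix_inv B)" for X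
    unfolding \<phi>_def \<psi>_def by (simp only: matrix_mul_assoc)
  then have \<psi>\<phi>: "\<psi> (\<phi> X) = X" for X
    using assms(1,2) by (simp add: matrix_inv_left matrix_inv_right)
  have "C ** \<psi> Y ** D = ?G ** Y ** ?H" for Y
    unfolding \<psi>_def by (simp only: matrix_mul_assoc)
  \<comment> \<open>Writing \<open>X\<close> as \<open>\<psi> (\<phi> X)\<close> turns
    \<open>C ** X ** D\<close> into \<open>?G ** \<phi> X ** ?H\<close>; the rest is moving the
    absolute value across the equation.\<close>
  then have "A ** X ** B - \<bar>C ** X ** D\<bar> = F \<longleftrightarrow> F + \<bar>?G ** \<phi> X ** ?H\<bar> = \<phi> X" for X
    using \<psi>\<phi>[of X] \<phi>_def[of X] by (metis add_diff_cancel_right' diff_add_cancel)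
  then show "\<exists>!X. A ** X ** B - \<bar>C ** X ** D\<bar> = F"
    using ex1_fixed_point_abs[OF assms(3), of F] \<phi>\<psi> \<psi>\<phi> by metis
qed

end
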